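(* Let $X$ be a metric space equipped with a closed partial order $\le$, and let $\mu,\nu\in\mathcal{P}(X)$. Then the following are equivalent: (1) $\mu\le\nu$ in the stochastic order; (2) $\mu(A)\le\nu(A)$ for each closed upper set $A\subseteq X$; (3) $\mu(B)\le\nu(B)$ for each Borel upper set $B\subseteq X$.
   Context: A partial order $\le$ on a metric space $X$ is closed if $\{(x,y):x\le y\}$ is closed in $X\times X$. A subset $A\subseteq X$ is an upper set if $x\in A$ and $x\le y$ imply $y\in A$. $\mathcal{P}(X)$ denotes the set of Borel probability measures $\mu$ on $X$ satisfying all four of the following conditions: the support of $\mu$ has measure $1$; $\mu$ is $\tau$-additive, i.e. $\mu(U)=\sup_\alpha\mu(U_\alpha)$ for every directed union $U=\bigcup_\alpha U_\alpha$ of open sets; $\mu$ is the weak limit of a sequence of finitely supported measures; $\mu$ is inner regular, i.e. for every Borel set $A$ and $\varepsilon>0$ there is a compact $K\subseteq A$ with $\mu(A)-\varepsilon<\mu(K)$. (The first three are always equivalent, and all four are equivalent when $X$ is complete.) The stochastic order on $\mathcal{P}(X)$ is defined by: $\mu\le\nu$ if $\mu(U)\le\nu(U)$ for each open upper set $U\subseteq X$. *)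

theory Defs
  imports "HOL-Probability.Probability"
begin

definition upper_set :: "('a \<times> 'a) set \<Rightarrow> 'a set \<Rightarrow> bool" where
  "upper_set r A \<longleftrightarrow> (\<forall>x y. x \<in> A \<longrightarrow> (x, y) \<in> r \<longrightarrow> y \<in> A)"

definition msupport :: "'a::topological_space measure \<Rightarrow> 'a set" where
  "msupport M = {x. \<forall>U. open U \<longrightarrow> x \<in> U \<longrightarrow> measure M U > 0}"

text \<open>Directed families are taken to be nonempty. The supremum is formed in the complete lattice
  of extended nonnegative reals, so that it never is a default value.\<close>

definition tau_additive :: "'a::topological_space measure \<Rightarrow> bool" where
  "tau_additive M \<longleftrightarrow>
     (\<forall>\<U>. \<U> \<noteq> {} \<longrightarrow> (\<forall>U\<in>\<U>. open U) \<longrightarrow>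
        (\<forall>U\<in>\<U>. \<forall>V\<in>\<U>. \<exists>W\<in>\<U>. U \<subseteq> W \<and> V \<subseteq> W) \<longrightarrow>
        emeasure M (\<Union>\<U>) = (SUP U\<in>\<U>. emeasure M U))"

text \<open>The library's \<open>weak_conv_m\<close> only covers measures on the real line, hence the usual
  definition by bounded continuous test functions.\<close>

definition weak_limit :: "(nat \<Rightarrow> 'a::topological_space measure) \<Rightarrow> 'a measure \<Rightarrow> bool" where
  "weak_limit N M \<longleftrightarrow>
     (\<forall>f :: 'a \<Rightarrow> real. continuous_on UNIV f \<longrightarrow> bounded (range f) \<longrightarrow>
        (\<lambda>n. integral\<^sup>L (N n) f) \<longlonglongrightarrow> integral\<^sup>L M f)"

text \<open>Total mass one is not demanded here: if such measures converge weakly to a probability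
  measure, then their masses converge to one, and they can be normalized.\<close>

definition finitely_supported :: "'a::t1_space measure \<Rightarrow> bool" where
  "finitely_supported M \<longleftrightarrow>
     sets M = sets borel \<and> finite_measure M \<and> (\<exists>S. finite S \<and> emeasure M (- S) = 0)"

definition inner_regular :: "'a::t2_space measure \<Rightarrow> bool" where
  "inner_regular M \<longleftrightarrow>
     (\<forall>A\<in>sets borel. \<forall>\<epsilon>>0. \<exists>K. compact K \<and> K \<subseteq> A \<and> measure M A - \<epsilon> < measure M K)"

definition prob_measures :: "'a::metric_space measure set" where
  "prob_measures = {M. sets M = sets borel \<and> prob_space M \<and>
     measure M (msupport M) = 1 \<and>
     tau_additive M \<and>
     (\<exists>N. (\<forall>n. finitely_supported (N n)) \<and> weak_limit N M) \<and>
     inner_regular M}"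

definition stoch_le :: "('a \<times> 'a) set \<Rightarrow> 'a::metric_space measure \<Rightarrow> 'a measure \<Rightarrow> bool" where
  "stoch_le r \<mu> \<nu> \<longleftrightarrow> (\<forall>U. open U \<longrightarrow> upper_set r U \<longrightarrow> measure \<mu> U \<le> measure \<nu> U)"

end

theory Submission
  imports Defs
begin

text \<open>The closed upper sets generated by compact sets approximate every Borel upper set from
  inside, by inner regularity. This extends the inequality from closed to Borel upper sets. The
  stochastic order is, by complements, the reversed inequality on closed lower sets, so the same
  argument for the converse order and for the exchanged measures applies to it.\<close>

text \<open>If \<open>y n\<close> tends to \<open>l\<close> and each \<open>y n\<close> is related
  to some \<open>x n\<close> in \<open>K\<close>, compactness yields a subsequence of the
  \<open>x n\<close> converging to a point of \<open>K\<close>. Closedness of \<open>r\<close> then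
  passes to the limit of the pairs. For a merely closed \<open>K\<close>, the points
  \<open>x n\<close> could escape and the image need not be closed.\<close>

lemma closed_Image_compact:
  fixes r :: "('a::metric_space \<times> 'b::metric_space) set"
  assumes "closed r" and "compact K"
  shows "closed (r `` K)"
  unfolding closed_sequential_limits
proof (intro allI impI, elim conjE)
  fix y l
  assume "\<forall>n. y n \<in> r `` K" and lim_y: "y \<longlonglongrightarrow> l"
  then obtain x where x: "\<And>n. x n \<in> K" "\<And>n. (x n, y n) \<in> r"
    by (simp add: Image_iff Bex_def) metis
  with \<open>compact K\<close> obtain k \<phi>
    where "k \<in> K" and \<phi>: "strict_mono \<phi>" and lim_x: "(x \<circ> \<phi>) \<longlonglongrightarrow> k"
    using compact_imp_seq_compact seq_compactE by metis
  have "(\<lambda>n. ((x \<circ> \<phi>) n, (y \<circ> \<phi>) n)) \<longlonglongrightarrow> (k, l)"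
    using lim_x LIMSEQ_subseq_LIMSEQ[OF lim_y \<phi>] by (rule tendsto_Pair)
  then have "(k, l) \<in> r"
    by (rule closed_sequentially[OF \<open>closed r\<close>, rotated]) (simp add: x)
  with \<open>k \<in> K\<close> show "l \<in> r `` K" by blast
qed

lemma closed_converse:
  fixes r :: "('a::topological_space \<times> 'b::topological_space) set"
  assumes "closed r"
  shows "closed (r\<inverse>)"
proof -
  have "closed (prod.swap -` r)"
    using assms by (rule closed_vimage) (rule continuous_on_swap)
  moreover have "prod.swap -` r = r\<inverse>" by auto
  ultimately show ?thesis by simp
qed

text \<open>The upper sets of the converse relation are the lower sets of \<open>r\<close>, and
  complementation exchanges lower and upper sets.\<close>

lemma upper_set_converse_Compl [simp]: "upper_set (r\<inverse>) (- A) \<longleftrightarrow> upper_set r A"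
  unfolding upper_set_def by blast

lemma upper_set_Image: "trans r \<Longrightarrow> upper_set r (r `` A)"
  unfolding upper_set_def by (blast dest: transD)

lemma Image_subset_upper_set: "upper_set r B \<Longrightarrow> A \<subseteq> B \<Longrightarrow> r `` A \<subseteq> B"
  unfolding upper_set_def by blast

lemma measure_Compl_le_iff:
  assumes "prob_space \<mu>" "prob_space \<nu>"
    and "sets \<mu> = sets borel" "sets \<nu> = sets borel" and "A \<in> sets borel"
  shows "measure \<nu> (- A) \<le> measure \<mu> (- A) \<longleftrightarrow> measure \<mu> A \<le> measure \<nu> A"
proof -
  have "space \<mu> = UNIV" "space \<nu> = UNIV"
    using assms(3,4) by (auto dest: sets_eq_imp_space_eq)
  then show ?thesis
    using prob_space.prob_compl[of \<mu> A] prob_space.prob_compl[of \<nu> A] assms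
    by (simp add: Compl_eq_Diff_UNIV)
qed

lemma measure_le_upper_sets_closed_to_borel:
  fixes r :: "('a::metric_space \<times> 'a) set" and \<mu> \<nu> :: "'a measure"
  assumes r: "refl r" "trans r" "closed r"
    and \<mu>: "finite_measure \<mu>" "sets \<mu> = sets borel" "inner_regular \<mu>"
    and \<nu>: "finite_measure \<nu>" "sets \<nu> = sets borel"
    and le: "\<And>A. closed A \<Longrightarrow> upper_set r A \<Longrightarrow> measure \<mu> A \<le> measure \<nu> A"
    and B: "B \<in> sets borel" "upper_set r B"
  shows "measure \<mu> B \<le> measure \<nu> B"
proof (rule field_le_epsilon)
  fix e :: real
  assume "e > 0"
  with \<mu>(3) B(1) obtain K
    where K: "compact K" "K \<subseteq> B" "measure \<mu> B - e < measure \<mu> K"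
    unfolding inner_regular_def by blast
  have cl: "closed (r `` K)" using r(3) K(1) by (rule closed_Image_compact)
  have "K \<subseteq> r `` K" using r(1) by (auto dest: reflD)
  with cl have "measure \<mu> K \<le> measure \<mu> (r `` K)"
    by (intro finite_measure.finite_measure_mono \<mu>(1)) (simp_all add: \<mu>(2))
  also have "\<dots> \<le> measure \<nu> (r `` K)" using cl upper_set_Image[OF r(2)] by (rule le)
  also have "\<dots> \<le> measure \<nu> B"
    using B(1) Image_subset_upper_set[OF B(2) K(2)]
    by (intro finite_measure.finite_measure_mono \<nu>(1)) (simp_all add: \<nu>(2))
  finally show "measure \<mu> B \<le> measure \<nu> B + e" using K(3) by simp
qed

theorem proposition3p4:
  fixes r :: "('a::metric_space \<times> 'a) set"
    and \<mu> \<nu> :: "'a measure"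
  assumes "partial_order_on UNIV r"
    and "closed r"
    and "\<mu> \<in> prob_measures"
    and "\<nu> \<in> prob_measures"
  shows "(stoch_le r \<mu> \<nu> \<longleftrightarrow>
            (\<forall>A. closed A \<longrightarrow> upper_set r A \<longrightarrow> measure \<mu> A \<le> measure \<nu> A)) \<and>
         (stoch_le r \<mu> \<nu> \<longleftrightarrow>
            (\<forall>B\<in>sets borel. upper_set r B \<longrightarrow> measure \<mu> B \<le> measure \<nu> B))"
proof -
  have r: "refl r" "trans r"
    using assms(1) by (auto simp: partial_order_on_def preorder_on_def)
  have \<mu>: "prob_space \<mu>" "sets \<mu> = sets borel" "inner_regular \<mu>"
    and \<nu>: "prob_space \<nu>" "sets \<nu> = sets borel" "inner_regular \<nu>"
    using assms(3,4) by (auto simp: prob_measures_def)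
  note fin = \<mu>(1)[THEN prob_space.finite_measure] \<nu>(1)[THEN prob_space.finite_measure]
  note Compl_le = measure_Compl_le_iff[OF \<mu>(1) \<nu>(1) \<mu>(2) \<nu>(2)]
  have closed_imp_borel: "measure \<mu> B \<le> measure \<nu> B"
    if "\<forall>A. closed A \<longrightarrow> upper_set r A \<longrightarrow> measure \<mu> A \<le> measure \<nu> A"
      and "B \<in> sets borel" "upper_set r B" for B
    using that measure_le_upper_sets_closed_to_borel[OF r assms(2) fin(1) \<mu>(2,3) fin(2) \<nu>(2)]
    by blast
  have open_imp_borel: "measure \<mu> B \<le> measure \<nu> B"
    if le: "stoch_le r \<mu> \<nu>" and B: "B \<in> sets borel" "upper_set r B" for B
  proof -
    \<comment> \<open>A closed set that is upper for the converse order has an open complement that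
      is upper for \<open>r\<close>. Since both total masses are 1, passing to complements reverses
      the inequality.\<close>
    have "measure \<nu> A \<le> measure \<mu> A" if "closed A" "upper_set (r\<inverse>) A" for A
    proof -
      have "open (- A)" "upper_set r (- A)"
        using that upper_set_converse_Compl[of r "- A"] by auto
      with le have "measure \<mu> (- A) \<le> measure \<nu> (- A)" by (simp add: stoch_le_def)
      with Compl_le[of "- A"] \<open>closed A\<close> show ?thesis by simp
    qed
    \<comment> \<open>Here \<nu> is on the smaller side, so its inner regularity is the one used:
      compact subsets of \<open>- B\<close> generate closed lower sets inside
      \<open>- B\<close>.\<close>
    then have "measure \<nu> (- B) \<le> measure \<mu> (- B)"
      using r assms(2) B
      by - (rule measure_le_upper_sets_closed_to_borel[of "r\<inverse>", OF _ _ _ fin(2) \<nu>(2,3) fin(1) \<mu>(2)],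
          auto simp: closed_converse)
    with Compl_le B(1) show ?thesis by simp
  qed
  let ?closed_le = "\<forall>A. closed A \<longrightarrow> upper_set r A \<longrightarrow> measure \<mu> A \<le> measure \<nu> A"
    and ?borel_le = "\<forall>B\<in>sets borel. upper_set r B \<longrightarrow> measure \<mu> B \<le> measure \<nu> B"
  \<comment> \<open>The Borel statement is the hub: it specializes to open and to closed sets, and
    each of these two cases implies it back.\<close>
  have "?borel_le \<Longrightarrow> ?closed_le" "?borel_le \<Longrightarrow> stoch_le r \<mu> \<nu>"
    by (simp_all add: stoch_le_def)
  moreover have "?closed_le \<Longrightarrow> ?borel_le" using closed_imp_borel by simp
  moreover have "stoch_le r \<mu> \<nu> \<Longrightarrow> ?borel_le" using open_imp_borel by simp
  ultimately show ?thesis by argo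
qed

end
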